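(* Let $\mathcal{F}_c$ denote the class of connected graphs. Then for every positive integer $n$, $$M_{\mathcal{F}_c}(n)=2^{n-1}.$$
   Context: All graphs are finite and simple. For two graphs $G,G'$ on the vertex set $[n]=\{1,\dots,n\}$, $G\oplus G'$ denotes the graph on $[n]$ whose edge set is the symmetric difference of $E(G)$ and $E(G')$. For a class $\mathcal{F}$ of graphs, a family $\mathcal{G}$ of (labeled) graphs on vertex set $[n]$ is called $\mathcal{F}$-good if $G\oplus G'\in\mathcal{F}$ for any two distinct members $G,G'\in\mathcal{G}$. $M_{\mathcal{F}}(n)$ denotes the maximum possible size of an $\mathcal{F}$-good family on vertex set $[n]$. A graph on $[n]$ is connected if it has a single connected component containing all of its vertices (in particular, isolated vertices are not ignored). *)

theory Defs
  imports "Graph_Theory.Digraph_Component"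
begin

text \<open>
  Finite simple graphs are values satisfying \<^const>\<open>pair_graph\<close>: a finite vertex set together
  with a symmetric, irreflexive set of arcs on it. An undirected edge between \<open>u\<close> and \<open>v\<close> is
  the pair of arcs \<open>(u, v)\<close>, \<open>(v, u)\<close>, so graphs correspond one-to-one to sets of unordered
  edges, and taking the symmetric difference of arc sets is taking that of edge sets.
\<close>

definition graphs_on :: "nat \<Rightarrow> nat pair_pre_digraph set" where
  "graphs_on n = {G. pair_graph G \<and> pverts G = {1..n}}"

text \<open>
  The operation is only used on two graphs with the same vertex set, so it does not matter
  which of the two vertex sets is kept.
\<close>

definition graph_sym_diff ::
    "'a pair_pre_digraph \<Rightarrow> 'a pair_pre_digraph \<Rightarrow> 'a pair_pre_digraph"  (infixl "\<oplus>" 65) where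
  "G \<oplus> H = \<lparr>pverts = pverts G, parcs = sym_diff (parcs G) (parcs H)\<rparr>"

definition good_family ::
    "nat pair_pre_digraph set \<Rightarrow> nat \<Rightarrow> nat pair_pre_digraph set \<Rightarrow> bool" where
  "good_family \<F> n \<G> \<longleftrightarrow>
     \<G> \<subseteq> graphs_on n \<and> (\<forall>G\<in>\<G>. \<forall>H\<in>\<G>. G \<noteq> H \<longrightarrow> G \<oplus> H \<in> \<F>)"

definition max_good :: "nat pair_pre_digraph set \<Rightarrow> nat \<Rightarrow> nat" where
  "max_good \<F> n = Max {card \<G> |\<G>. good_family \<F> n \<G>}"

definition connected_graphs :: "nat pair_pre_digraph set" where
  "connected_graphs = {G. pair_graph G \<and> connected (with_proj G)}"

lemma graph_sym_diff_in_graphs_on: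
  assumes "G \<in> graphs_on n" "H \<in> graphs_on n"
  shows "G \<oplus> H \<in> graphs_on n"
proof -
  have G: "pair_graph G" "pverts G = {1..n}" and H: "pair_graph H" "pverts H = {1..n}"
    using assms by (auto simp: graphs_on_def)
  interpret G: pair_graph G by (rule G)
  interpret H: pair_graph H by (rule H)
  have "pair_graph (G \<oplus> H)"
  proof
    show "finite (parcs (G \<oplus> H))"
      using G.pair_finite_arcs H.pair_finite_arcs by (simp add: graph_sym_diff_def)
    have "sym (parcs G)" "sym (parcs H)"
      using G.pair_sym_arcs H.pair_sym_arcs by (auto simp: symmetric_def)
    then show "symmetric (with_proj (G \<oplus> H))"
      unfolding symmetric_def sym_def by (auto simp: graph_sym_diff_def)
  qed (use G(2) H(2) G.arc_fst_in_verts G.arc_snd_in_verts H.arc_fst_in_verts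
        H.arc_snd_in_verts G.pair_no_loops H.pair_no_loops in \<open>auto simp: graph_sym_diff_def\<close>)
  then show ?thesis
    using G(2) by (simp add: graphs_on_def graph_sym_diff_def)
qed

lemma finite_graphs_on: "finite (graphs_on n)"
proof (rule finite_subset)
  show "graphs_on n \<subseteq> (\<lambda>A. \<lparr>pverts = {1..n}, parcs = A\<rparr>) ` Pow ({1..n} \<times> {1..n})"
  proof
    fix G assume G: "G \<in> graphs_on n"
    then interpret pair_graph G by (simp add: graphs_on_def)
    have "parcs G \<subseteq> {1..n} \<times> {1..n}"
      using G arc_fst_in_verts arc_snd_in_verts by (fastforce simp: graphs_on_def)
    moreover have "G = \<lparr>pverts = {1..n}, parcs = parcs G\<rparr>"
      using G by (simp add: graphs_on_def)
    ultimately show "G \<in> (\<lambda>A. \<lparr>pverts = {1..n}, parcs = A\<rparr>) ` Pow ({1..n} \<times> {1..n})"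
      by blast
  qed
qed simp

text \<open>The maximum in \<^const>\<open>max_good\<close> is over a finite nonempty set, hence is attained.\<close>

lemma finite_good_family_cards: "finite {card \<G> |\<G>. good_family \<F> n \<G>}"
proof (rule finite_subset)
  show "{card \<G> |\<G>. good_family \<F> n \<G>} \<subseteq> card ` Pow (graphs_on n)"
    by (auto simp: good_family_def)
qed (simp add: finite_graphs_on)

lemma good_family_cards_nonempty: "{card \<G> |\<G>. good_family \<F> n \<G>} \<noteq> {}"
proof -
  have "good_family \<F> n {}" by (simp add: good_family_def)
  then show ?thesis by blast
qed

end

theory Submission
  imports Defs
begin

text \<open>
  In a connected graph on at least two vertices no vertex is isolated. Hence two distinct members
  of a good family never have the same neighbourhood at vertex \<open>1\<close>: if they did, vertex \<open>1\<close>
  would be isolated in their symmetric difference. So \<open>G \<mapsto> N\<^sub>G(1)\<close> embeds the family into the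
  power set of \<open>{2..n}\<close> (\<open>card_good_family_le\<close>), which has \<open>2\<^sup>n\<^sup>-\<^sup>1\<close> elements. For \<open>n = 1\<close> there
  is only one graph, so the embedding is trivial.

  The bound is attained by the cut space of the complete graph. The cut defined by \<open>A\<close> consists of
  all edges between \<open>A\<close> and its complement. Cuts are closed under symmetric difference, the sum of
  the cuts of \<open>A\<close> and \<open>B\<close> being the cut of \<open>sym_diff A B\<close>, and a cut with two nonempty sides is a
  complete bipartite graph, hence connected. Choosing the side of each cut that avoids vertex \<open>1\<close>
  indexes the cuts by the subsets of \<open>{2..n}\<close>; a nonempty such subset has \<open>1\<close> in its complement,
  so both sides are nonempty (\<open>good_family_cuts\<close>).
\<close>

definition neighbourhood :: "'a pair_pre_digraph \<Rightarrow> 'a \<Rightarrow> 'a set" where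
  "neighbourhood G u = parcs G `` {u}"

definition cut_graph :: "'a set \<Rightarrow> 'a set \<Rightarrow> 'a pair_pre_digraph" where
  "cut_graph V A = \<lparr>pverts = V, parcs = {(u, v). u \<in> V \<and> v \<in> V \<and> (u \<in> A) \<noteq> (v \<in> A)}\<rparr>"

lemma pverts_cut_graph [simp]: "pverts (cut_graph V A) = V"
  by (simp add: cut_graph_def)

lemma parcs_cut_graph [simp]:
  "(u, v) \<in> parcs (cut_graph V A) \<longleftrightarrow> u \<in> V \<and> v \<in> V \<and> (u \<in> A) \<noteq> (v \<in> A)"
  by (simp add: cut_graph_def)

lemma neighbourhood_sym_diff:
  "neighbourhood (G \<oplus> H) u = sym_diff (neighbourhood G u) (neighbourhood H u)"
  by (auto simp: neighbourhood_def graph_sym_diff_def)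

lemma neighbourhood_subset:
  assumes "pair_graph G"
  shows "neighbourhood G u \<subseteq> pverts G - {u}"
proof -
  interpret pair_graph G by (rule assms)
  show ?thesis
    using arc_snd_in_verts pair_no_loops by (fastforce simp: neighbourhood_def)
qed

lemma connected_imp_neighbourhood_nonempty:
  assumes "pair_graph G" and "connected (with_proj G)"
    and "u \<in> pverts G" "v \<in> pverts G" "u \<noteq> v"
  shows "neighbourhood G u \<noteq> {}"
proof -
  interpret pair_graph G by (rule assms(1))
  have "u \<rightarrow>\<^sup>*\<^bsub>mk_symmetric (with_proj G)\<^esub> v"
    using assms(2-4) by (auto simp: connected_def strongly_connected_def)
  then have "u \<rightarrow>\<^sup>*\<^bsub>with_proj G\<^esub> v"
    using reachable_mk_symmetric_eq pair_sym_arcs by blast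
  then obtain w where "u \<rightarrow>\<^bsub>with_proj G\<^esub> w"
    using \<open>u \<noteq> v\<close> by (cases rule: converse_reachable_cases) auto
  then show ?thesis
    by (auto simp: neighbourhood_def)
qed

lemma card_good_family_le:
  assumes "n \<ge> 1" and "good_family connected_graphs n \<G>"
  shows "card \<G> \<le> 2 ^ (n - 1)"
proof -
  have graphs: "\<G> \<subseteq> graphs_on n"
    and good: "\<And>G H. G \<in> \<G> \<Longrightarrow> H \<in> \<G> \<Longrightarrow> G \<noteq> H \<Longrightarrow> G \<oplus> H \<in> connected_graphs"
    using assms(2) by (auto simp: good_family_def)
  have inj: "inj_on (\<lambda>G. neighbourhood G 1) \<G>"
  proof (rule inj_onI, rule ccontr)
    fix G H assume GH: "G \<in> \<G>" "H \<in> \<G>" "neighbourhood G 1 = neighbourhood H 1" "G \<noteq> H"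
    have isolated: "neighbourhood (G \<oplus> H) 1 = {}"
      using GH(3) by (simp add: neighbourhood_sym_diff)
    have conn: "pair_graph (G \<oplus> H)" "connected (with_proj (G \<oplus> H))"
      using good GH by (auto simp: connected_graphs_def)
    have verts: "pverts (G \<oplus> H) = {1..n}"
      using graphs GH by (auto simp: graphs_on_def graph_sym_diff_def)
    \<comment> \<open>An isolated vertex of a connected graph is its only vertex, so only \<open>n = 1\<close> remains.\<close>
    have "n = 1"
    proof (rule ccontr)
      assume "n \<noteq> 1"
      then have "1 \<in> pverts (G \<oplus> H)" "2 \<in> pverts (G \<oplus> H)"
        using assms(1) verts by auto
      then show False
        using connected_imp_neighbourhood_nonempty[OF conn, of 1 2] isolated by simp
    qed
    \<comment> \<open>There is only one graph on a single vertex.\<close>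
    have no_arcs: "parcs K = {}" if "K \<in> \<G>" for K
    proof -
      have K: "pair_graph K" "pverts K = {1}"
        using that graphs \<open>n = 1\<close> by (auto simp: graphs_on_def)
      interpret pair_graph K by (rule K(1))
      show ?thesis
        using K(2) arc_fst_in_verts arc_snd_in_verts pair_no_loops by fastforce
    qed
    have "pverts G = {1..n}" "pverts H = {1..n}"
      using graphs GH by (auto simp: graphs_on_def)
    then show False
      using \<open>G \<noteq> H\<close> no_arcs GH by simp
  qed
  have "(\<lambda>G. neighbourhood G 1) ` \<G> \<subseteq> Pow {2..n}"
  proof (rule image_subsetI)
    fix G assume "G \<in> \<G>"
    then have "neighbourhood G 1 \<subseteq> {1..n} - {1}"
      using graphs neighbourhood_subset[of G 1] by (auto simp: graphs_on_def)
    then show "neighbourhood G 1 \<in> Pow {2..n}"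
      by fastforce
  qed
  then have "card \<G> \<le> card (Pow {2..n})"
    by (intro card_inj_on_le[OF inj]) auto
  then show ?thesis
    by (simp add: card_Pow)
qed

lemma pair_graph_cut_graph:
  assumes "finite V"
  shows "pair_graph (cut_graph V A)"
proof
  have "parcs (cut_graph V A) \<subseteq> V \<times> V"
    by auto
  then show "finite (parcs (cut_graph V A))"
    using assms finite_subset by blast
  show "symmetric (with_proj (cut_graph V A))"
    by (auto simp: symmetric_def sym_def)
qed (use assms in auto)

text \<open>
  Vertices on opposite sides are adjacent, and two vertices on the same side have every vertex of
  the other side as a common neighbour.
\<close>

lemma connected_cut_graph:
  assumes "finite V" and "a \<in> V" "a \<in> A" and "b \<in> V" "b \<notin> A"
  shows "connected (with_proj (cut_graph V A))"
proof -
  interpret pair_graph "cut_graph V A"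
    using pair_graph_cut_graph[OF assms(1)] .
  have opposite: "u \<rightarrow>\<^sup>*\<^bsub>with_proj (cut_graph V A)\<^esub> v"
    if "u \<in> V" "v \<in> V" "(u \<in> A) \<noteq> (v \<in> A)" for u v
    using that by (intro reachable_adjI) simp
  have "u \<rightarrow>\<^sup>*\<^bsub>with_proj (cut_graph V A)\<^esub> v" if "u \<in> V" "v \<in> V" for u v
  proof (cases "(u \<in> A) = (v \<in> A)")
    case True
    obtain w where "w \<in> V" "(u \<in> A) \<noteq> (w \<in> A)"
      using assms by blast
    then show ?thesis
      using opposite[of u w] opposite[of w v] that True reachable_trans by blast
  qed (use opposite that in blast)
  then have "strongly_connected (with_proj (cut_graph V A))"
    using assms(2) by (auto simp: strongly_connected_def)
  then show ?thesis
    using reachable_mk_symmetric_eq[OF pair_sym_arcs]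
    by (simp add: connected_def strongly_connected_def)
qed

lemma cut_graph_sym_diff: "cut_graph V A \<oplus> cut_graph V B = cut_graph V (sym_diff A B)"
  by (auto simp: graph_sym_diff_def cut_graph_def)

text \<open>
  A cut determines its two sides only up to swapping them; excluding a vertex \<open>r\<close> from \<open>A\<close> picks
  one of them, namely the neighbourhood of \<open>r\<close>.
\<close>

lemma inj_on_cut_graph:
  assumes "r \<in> V"
  shows "inj_on (cut_graph V) (Pow (V - {r}))"
proof (rule inj_on_inverseI)
  fix A assume "A \<in> Pow (V - {r})"
  then show "neighbourhood (cut_graph V A) r = A"
    using assms by (auto simp: neighbourhood_def)
qed

lemma good_family_cuts:
  assumes "n \<ge> 1"
  shows "good_family connected_graphs n (cut_graph {1..n} ` Pow {2..n})"
  unfolding good_family_def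
proof (intro conjI ballI impI)
  show "cut_graph {1..n} ` Pow {2..n} \<subseteq> graphs_on n"
    by (auto simp: graphs_on_def pair_graph_cut_graph)
next
  fix G H
  assume "G \<in> cut_graph {1..n} ` Pow {2..n}" "H \<in> cut_graph {1..n} ` Pow {2..n}" "G \<noteq> H"
  then obtain A B where AB: "A \<subseteq> {2..n}" "B \<subseteq> {2..n}" "A \<noteq> B"
    and GH: "G = cut_graph {1..n} A" "H = cut_graph {1..n} B"
    by blast
  obtain a where a: "a \<in> sym_diff A B"
    using AB(3) by blast
  then have "a \<in> {1..n}"
    using AB by auto
  moreover have "1 \<notin> sym_diff A B"
    using AB by auto
  ultimately have "connected (with_proj (cut_graph {1..n} (sym_diff A B)))"
    using a assms by (intro connected_cut_graph[of _ a _ 1]) auto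
  then show "G \<oplus> H \<in> connected_graphs"
    by (simp add: GH cut_graph_sym_diff connected_graphs_def pair_graph_cut_graph)
qed

theorem theorem2:
  fixes n :: nat
  assumes "n \<ge> 1"
  shows "max_good connected_graphs n = 2 ^ (n - 1)"
proof -
  have "{1..n} - {1} = {2..n}"
    by auto
  then have "inj_on (cut_graph {1..n}) (Pow {2..n})"
    using inj_on_cut_graph[of 1 "{1..n}"] assms by simp
  then have "card (cut_graph {1..n} ` Pow {2..n}) = 2 ^ (n - 1)"
    by (simp add: card_image card_Pow)
  then have "2 ^ (n - 1) \<in> {card \<G> |\<G>. good_family connected_graphs n \<G>}"
    using good_family_cuts[OF assms] by (metis (mono_tags, lifting) mem_Collect_eq)
  then show ?thesis
    unfolding max_good_def
    using card_good_family_le[OF assms] finite_good_family_cards by (intro Max_eqI) auto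
qed

end
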